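(* Let $N\ge 1$ be an integer and $c>0$. The operator $L^{\mathrm{IRW}}$ is self-dual with duality function $$D(n,x)=\prod_{j=1}^N C(n_j,x_j;c),\qquad n,x\in\mathbb N^N,$$ i.e. $[L^{\mathrm{IRW}}D(\cdot,x)](n)=[L^{\mathrm{IRW}}D(n,\cdot)](x)$ for all $n,x\in\mathbb N^N$.
   Context: $\mathbb N$ is the set of nonnegative integers. $L^{\mathrm{IRW}}$ is the generator of the independent random walker process on $N$ sites: for $f:\mathbb N^N\to\mathbb C$, $$L^{\mathrm{IRW}}f(n)=\sum_{1\le i<j\le N}\Big[n_i\big(f(n^{i,j})-f(n)\big)+n_j\big(f(n^{j,i})-f(n)\big)\Big],\qquad n\in\mathbb N^N,$$ where $n^{i,j}=n-e_i+e_j$ with $e_i$ the $i$-th standard basis vector (a term with prefactor $n_i=0$ is zero). The Charlier polynomials are $C_n(x;c)=\sum_{m=0}^{n}\frac{(-n)_m(-x)_m}{m!}\left(-\frac1c\right)^m$, where $(a)_m=a(a+1)\cdots(a+m-1)$, $(a)_0=1$, and $C(n,x;c)=e^{c}\,C_n(x;c)$. *)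

theory Defs
  imports "HOL-Analysis.Analysis"
begin

text \<open>
  The sites are the elements of a finite linearly ordered type \<open>'N\<close>, so \<open>N = CARD('N)\<close> and
  a configuration is a vector of type \<open>nat ^ 'N\<close>.
\<close>

text \<open>
  \<open>n\<^sup>i\<^sup>,\<^sup>j = n - e\<^sub>i + e\<^sub>j\<close>. The subtraction is componentwise and truncated, hence only
  meaningful if \<open>n $ i > 0\<close>; in the generator the case \<open>n $ i = 0\<close> has coefficient \<open>0\<close>.
\<close>
definition jump :: "nat ^ 'N \<Rightarrow> 'N \<Rightarrow> 'N \<Rightarrow> nat ^ 'N" where
  "jump n i j = n - axis i 1 + axis j 1"

definition L_IRW :: "(nat ^ ('N::{finite, linorder}) \<Rightarrow> complex) \<Rightarrow> nat ^ ('N::{finite, linorder}) \<Rightarrow> complex" where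
  "L_IRW f n = (\<Sum>(i, j) \<in> {(i, j). i < j}.
     of_nat (n $ i) * (f (jump n i j) - f n) + of_nat (n $ j) * (f (jump n j i) - f n))"

definition charlier_poly :: "nat \<Rightarrow> real \<Rightarrow> real \<Rightarrow> real" where
  "charlier_poly n x c =
     (\<Sum>m = 0..n. pochhammer (- real n) m * pochhammer (- x) m / fact m * (- (1 / c)) ^ m)"

definition charlier :: "nat \<Rightarrow> nat \<Rightarrow> real \<Rightarrow> real" where
  "charlier n x c = exp c * charlier_poly n (real x) c"

definition charlier_duality :: "real \<Rightarrow> nat ^ 'N \<Rightarrow> nat ^ 'N \<Rightarrow> complex" where
  "charlier_duality c n x = (\<Prod>j\<in>UNIV. complex_of_real (charlier (n $ j) (x $ j) c))"

definition self_dual :: "(('a \<Rightarrow> complex) \<Rightarrow> 'a \<Rightarrow> complex) \<Rightarrow> ('a \<Rightarrow> 'a \<Rightarrow> complex) \<Rightarrow> bool" where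
  "self_dual L D \<longleftrightarrow> (\<forall>n x. L (\<lambda>n'. D n' x) n = L (\<lambda>x'. D n x') x)"

end

theory Submission
  imports Defs
begin

text \<open>
  Summing over pairs of sites reduces self-duality to an identity for two sites. The Charlier
  polynomials are symmetric in degree and argument, so the lowering relation
  \<open>x C(n, x - 1) = c (C(n, x) - C(n + 1, x))\<close> and its mirror image trade every shift of the
  argument for a shift of the degree. Combining the two relations also yields the three-term
  recurrence, and these three facts imply the two-site identity.
\<close>

text \<open>Since \<open>pochhammer (- real k) m\<close> is a signed multiple of a binomial
  coefficient, the terms with \<open>m > n\<close> vanish. The free bound \<open>K\<close> puts
  polynomials of different degrees over one index range, and the summand is visibly symmetric in
  \<open>n\<close> and \<open>x\<close>.\<close>

lemma charlier_poly_binomial: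
  assumes "n \<le> K"
  shows "charlier_poly n (real x) c =
    (\<Sum>m\<le>K. real (n choose m) * real (x choose m) * fact m * (- (1 / c)) ^ m)"
proof -
  have poch: "pochhammer (- real k) m = (-1) ^ m * fact m * real (k choose m)" for k m
    by (simp add: binomial_gbinomial gbinomial_pochhammer flip: power_mult_distrib)
  have "charlier_poly n (real x) c =
      (\<Sum>m = 0..n. real (n choose m) * real (x choose m) * fact m * (- (1 / c)) ^ m)"
    unfolding charlier_poly_def poch
    by (intro sum.cong refl) (simp add: field_simps flip: power_mult_distrib)
  also have "\<dots> = (\<Sum>m\<le>K. real (n choose m) * real (x choose m) * fact m * (- (1 / c)) ^ m)"
    using assms by (intro sum.mono_neutral_left) auto
  finally show ?thesis .
qed

lemma charlier_commute: "charlier n x c = charlier x n c"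
  by (simp add: charlier_def charlier_poly_binomial[of n "max n x" x]
      charlier_poly_binomial[of x "max n x" n] mult_ac)

text \<open>Pascal's rule lowers the degree difference to a sum over \<open>n choose m\<close>;
  absorption of the factor \<open>Suc m\<close> then moves the shift to the argument. For
  \<open>x = 0\<close> both sides vanish, so the truncated \<open>x - 1\<close> is harmless.\<close>

lemma charlier_Suc_degree:
  assumes "c \<noteq> 0"
  shows "real x * charlier n (x - 1) c = c * (charlier n x c - charlier (Suc n) x c)"
proof -
  let ?t = "- (1 / c)"
  have absorb: "real x * real ((x - 1) choose m) = real (Suc m) * real (x choose Suc m)" for m
    using Suc_times_binomial_eq[of "x - 1" m] by (cases x) (simp_all add: mult.commute flip: of_nat_mult
        del: binomial_Suc_Suc of_nat_Suc)
  have "charlier_poly (Suc n) (real x) c - charlier_poly n (real x) c =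
      (\<Sum>m\<le>Suc n. real ((Suc n choose m) - (n choose m)) * real (x choose m) * fact m * ?t ^ m)"
    by (simp add: charlier_poly_binomial[of _ "Suc n"] sum_subtractf[symmetric] of_nat_diff
        binomial_mono left_diff_distrib binomial_right_mono del: sum.atMost_Suc)
  \<comment> \<open>The term \<open>m = 0\<close> is zero, as both binomials are 1; Pascal's rule
    applies after the index shift.\<close>
  also have "\<dots> = (\<Sum>m\<le>n. real (n choose m) * real (x choose Suc m) * fact (Suc m) * ?t ^ Suc m)"
    by (subst sum.atMost_Suc_shift) simp
  also have "\<dots> = (\<Sum>m\<le>n. ?t * (real (n choose m) * (real (Suc m) * real (x choose Suc m)) *
      fact m * ?t ^ m))"
    by (intro sum.cong refl) (simp add: mult_ac)
  also have "\<dots> = ?t * (real x * charlier_poly n (real (x - 1)) c)"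
    unfolding charlier_poly_binomial[OF order_refl] sum_distrib_left absorb[symmetric]
    by (intro sum.cong refl) (simp add: mult_ac)
  finally have "real x * charlier_poly n (real (x - 1)) c =
      c * (charlier_poly n (real x) c - charlier_poly (Suc n) (real x) c)"
    using assms by (simp add: field_simps)
  from arg_cong[OF this, of "\<lambda>r. exp c * r"] show ?thesis
    by (simp add: charlier_def algebra_simps)
qed

lemma charlier_Suc_arg:
  assumes "c \<noteq> 0"
  shows "c * charlier n (Suc x) c = c * charlier n x c - real n * charlier (n - 1) x c"
  using charlier_Suc_degree[OF assms, of n x]
  by (simp add: charlier_commute[of _ n] charlier_commute[of "Suc x"] charlier_commute[of x] algebra_simps)

text \<open>The lowering relation at argument \<open>Suc x\<close> has \<open>charlier n x c\<close>
  on its left; \<open>charlier_Suc_arg\<close> brings both values on its right back from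
  \<open>Suc x\<close> to \<open>x\<close>.\<close>

lemma charlier_recurrence:
  assumes "c \<noteq> 0"
  shows "real x * charlier n x c =
    (real n + c) * charlier n x c - c * charlier (Suc n) x c - real n * charlier (n - 1) x c"
  using charlier_Suc_degree[OF assms, of "Suc x" n] charlier_Suc_arg[OF assms, of n x]
    charlier_Suc_arg[OF assms, of "Suc n" x]
  by (simp add: algebra_simps)

lemma charlier_two_site_duality:
  assumes "c \<noteq> 0"
  defines "A \<equiv> \<lambda>n x. charlier n x c"
  shows "real n * (A (n - 1) x * A (Suc m) y - A n x * A m y) +
      real m * (A (Suc n) x * A (m - 1) y - A n x * A m y) =
    real x * (A n (x - 1) * A m (Suc y) - A n x * A m y) +
      real y * (A n (Suc x) * A m (y - 1) - A n x * A m y)"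
proof -
  have arg: "A k (Suc z) = A k z - real k * A (k - 1) z / c" for k z
    using charlier_Suc_arg[OF assms(1), of k z] assms(1) by (simp add: A_def field_simps)
  have deg: "real z * A k (z - 1) = c * (A k z - A (Suc k) z)" for k z
    unfolding A_def by (rule charlier_Suc_degree[OF assms(1)])
  have rec: "real z * A k z = (real k + c) * A k z - c * A (Suc k) z - real k * A (k - 1) z" for k z
    unfolding A_def by (rule charlier_recurrence[OF assms(1)])
  \<comment> \<open>Each prefactor is attached to the factor at its own site, so that
    \<open>deg\<close> applies to the jump terms and \<open>rec\<close> to the diagonal
    ones.\<close>
  have "real x * (A n (x - 1) * A m (Suc y) - A n x * A m y) +
      real y * (A n (Suc x) * A m (y - 1) - A n x * A m y) =
    (real x * A n (x - 1)) * A m (Suc y) - (real x * A n x) * A m y +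
      A n (Suc x) * (real y * A m (y - 1)) - A n x * (real y * A m y)"
    by (simp add: algebra_simps)
  \<comment> \<open>The terms with factor \<open>c\<close> cancel within each jump direction, while
    \<open>real n * A (n - 1) x * A m y\<close> and \<open>real m * A n x * A (m - 1) y\<close>
    cancel only between the two directions.\<close>
  also have "\<dots> = real n * (A (n - 1) x * A (Suc m) y - A n x * A m y) +
      real m * (A (Suc n) x * A (m - 1) y - A n x * A m y)"
    unfolding deg rec arg using assms(1) by (simp add: field_simps)
  finally show ?thesis by simp
qed

lemma jump_nth:
  assumes "i \<noteq> j"
  shows "jump n i j $ k = (if k = i then n $ i - 1 else if k = j then Suc (n $ j) else n $ k)"
  using assms by (auto simp: jump_def axis_def)

lemma prod_UNIV_split_pair:
  fixes f :: "'a::finite \<Rightarrow> 'b::comm_monoid_mult"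
  assumes "i \<noteq> j"
  shows "(\<Prod>k\<in>UNIV. f k) = f i * f j * (\<Prod>k\<in>UNIV - {i, j}. f k)"
  using assms prod.subset_diff[of "{i, j}" UNIV f] by (simp add: mult_ac)

theorem theorem3p6:
  fixes c :: real
  assumes "c > 0"
  shows "self_dual (L_IRW :: (nat ^ ('N::{finite, linorder}) \<Rightarrow> complex) \<Rightarrow> nat ^ ('N::{finite, linorder}) \<Rightarrow> complex)
           (charlier_duality c)"
proof -
  have "of_nat (n $ i) * (charlier_duality c (jump n i j) x - charlier_duality c n x) +
      of_nat (n $ j) * (charlier_duality c (jump n j i) x - charlier_duality c n x) =
    of_nat (x $ i) * (charlier_duality c n (jump x i j) - charlier_duality c n x) +
      of_nat (x $ j) * (charlier_duality c n (jump x j i) - charlier_duality c n x)"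
    if "i < j" for i j :: 'N and n x
  proof -
    have ij: "i \<noteq> j" "j \<noteq> i" using that by auto
    \<comment> \<open>Jumps between \<open>i\<close> and \<open>j\<close> leave all other sites
      alone, so \<open>P\<close> is common to every term.\<close>
    define P where
      "P = (\<Prod>k\<in>UNIV - {i, j}. complex_of_real (charlier (n $ k) (x $ k) c))"
    have split: "charlier_duality c n' x' =
        complex_of_real (charlier (n' $ i) (x' $ i) c * charlier (n' $ j) (x' $ j) c) * P"
      if "\<And>k. k \<notin> {i, j} \<Longrightarrow> n' $ k = n $ k" "\<And>k. k \<notin> {i, j} \<Longrightarrow> x' $ k = x $ k" for n' x'
      unfolding charlier_duality_def P_def prod_UNIV_split_pair[OF ij(1)]
      using that by simp
    have jumped: "charlier_duality c (jump n i j) x =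
        complex_of_real (charlier (n $ i - 1) (x $ i) c * charlier (Suc (n $ j)) (x $ j) c) * P"
      "charlier_duality c (jump n j i) x =
        complex_of_real (charlier (Suc (n $ i)) (x $ i) c * charlier (n $ j - 1) (x $ j) c) * P"
      "charlier_duality c n (jump x i j) =
        complex_of_real (charlier (n $ i) (x $ i - 1) c * charlier (n $ j) (Suc (x $ j)) c) * P"
      "charlier_duality c n (jump x j i) =
        complex_of_real (charlier (n $ i) (Suc (x $ i)) c * charlier (n $ j) (x $ j - 1) c) * P"
      using ij by (subst split; simp add: jump_nth)+
    have "c \<noteq> 0" using assms by simp
    \<comment> \<open>The real two-site identity, embedded in the complex numbers and multiplied by
      \<open>P\<close>, is the claim for the pair.\<close>
    from charlier_two_site_duality[OF this, of "n $ i" "x $ i" "n $ j" "x $ j",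
        THEN arg_cong, of "\<lambda>r. complex_of_real r * P"]
    show ?thesis
      unfolding jumped split[OF refl refl] by (simp only: of_real_mult of_real_add of_real_diff
          of_real_of_nat_eq distrib_right left_diff_distrib right_diff_distrib mult.assoc)
  qed
  then show ?thesis
    unfolding self_dual_def L_IRW_def by (auto intro!: sum.cong)
qed

end
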